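(* Let $F:\mathbb{R}^2\to\mathbb{R}^2$ be a lift of a $C^1$ positive twist map on $\mathbb{A}$. Let $(F_t)_t$ be an isotopy joining the identity of $\mathbb{R}^2$ to $F$, obtained as a lift of an isotopy in $\mathrm{Diff}^1(\mathbb{A})$ joining $\mathrm{Id}_{\mathbb{A}}$ to the twist map. Let $z_1,z_2\in\mathbb{R}^2$, $z_1\neq z_2$, be such that the limit defining their linking number exists. Then $$\mathrm{Linking}((F_t)_t,z_1,z_2)\in[-\pi,0].$$
   Context: $\mathbb{T}=\mathbb{R}/2\pi\mathbb{Z}$ and $\mathbb{A}=\mathbb{T}\times\mathbb{R}$, with universal cover $\mathbb{R}^2\to\mathbb{A}$, $(x,y)\mapsto(x \bmod 2\pi,y)$; $\mathbb{R}^2$ carries the Euclidean metric and the counterclockwise orientation. An isotopy joining the identity to a diffeomorphism $g$ of a manifold $S$ is a path $(g_t)_{t\in[0,1]}$ in $\mathrm{Diff}^1(S)$, continuous for the weak (compact-open) $C^1$ topology, with $g_0=\mathrm{Id}$, $g_1=g$; it is extended to $t\ge 0$ by $g_t=g_{\{t\}}\circ g^{\lfloor t\rfloor}$, where $\{t\}$ is the fractional part and $\lfloor t\rfloor$ the integer part of $t$. A positive twist map is a $C^1$ diffeomorphism $f:\mathbb{A}\to\mathbb{A}$ isotopic to the identity such that for any lift $F:\mathbb{R}^2\to\mathbb{R}^2$ of $f$ and any $x\in\mathbb{R}$, the function $\mathbb{R}\ni y\mapsto p_1\circ F(x,y)\in\mathbb{R}$ is an increasing diffeomorphism of $\mathbb{R}$,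 where $p_1$ is the first coordinate projection. For $z_1\neq z_2$ in $\mathbb{R}^2$ let $\tilde u$ be a continuous lift to $\mathbb{R}$ of $t\mapsto\theta(X,F_t(z_2)-F_t(z_1))\in\mathbb{T}$, $t\ge0$, where $X$ is a fixed constant non-zero vector (e.g. $(0,1)$) and $\theta(u,w)\in\mathbb{T}$ is the oriented angle from $u$ to $w$. Then $\mathrm{Linking}_n((F_t)_t,z_1,z_2)=\frac1n(\tilde u(n)-\tilde u(0))$ for $n\ge1$, and $\mathrm{Linking}((F_t)_t,z_1,z_2)=\lim_{n\to+\infty}\mathrm{Linking}_n((F_t)_t,z_1,z_2)$ whenever the limit exists. *)

theory Defs
  imports "HOL-Analysis.Analysis"
begin

text \<open>The circle \<open>\<real>/2\<pi>\<int>\<close> is modelled by the unit circle of the complex plane, the class of \<open>x\<close>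
  being \<open>cis x\<close>. The annulus is then a submanifold of \<open>complex \<times> real\<close>, and a map of the annulus
  is a function on \<open>complex \<times> real\<close> of which only the values on the annulus matter.\<close>

definition annulus :: "(complex \<times> real) set" where
  "annulus = sphere 0 1 \<times> UNIV"

definition annulus_cover :: "real \<times> real \<Rightarrow> complex \<times> real" where
  "annulus_cover z = (cis (fst z), snd z)"

lemma range_annulus_cover: "range annulus_cover = annulus"
proof
  show "range annulus_cover \<subseteq> annulus"
    by (auto simp: annulus_cover_def annulus_def)
  show "annulus \<subseteq> range annulus_cover"
  proof
    fix a assume "a \<in> annulus"
    then have "norm (fst a) = 1" by (auto simp: annulus_def)
    then have "cis (Arg (fst a)) = fst a"
      by (metis cis_Arg norm_zero sgn_eq zero_neq_one div_by_1 of_real_1)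
    then have "annulus_cover (Arg (fst a), snd a) = a"
      by (simp add: annulus_cover_def)
    then show "a \<in> range annulus_cover" by (metis rangeI)
  qed
qed

definition total_deriv ::
    "('a::real_normed_vector \<Rightarrow> 'b::real_normed_vector) \<Rightarrow> 'a \<Rightarrow> 'a \<Rightarrow>\<^sub>L 'b" where
  "total_deriv f z = Blinfun (frechet_derivative f (at z))"

definition C1_map :: "('a::real_normed_vector \<Rightarrow> 'b::real_normed_vector) \<Rightarrow> bool" where
  "C1_map f \<longleftrightarrow> (\<forall>z. f differentiable (at z)) \<and> continuous_on UNIV (total_deriv f)"

text \<open>In the next three definitions \<open>p\<close> is a surjective local diffeomorphism of a vector space onto
  a submanifold \<open>S = range p\<close> of a normed space, so that the local inverses of \<open>p\<close> form a \<open>C\<^sup>1\<close>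
  atlas of \<open>S\<close>. They are used for \<open>p = id\<close> (\<open>S\<close> the line or the plane) and for
  \<open>p = annulus_cover\<close> (\<open>S\<close> the annulus). A map \<open>g\<close> from \<open>S\<close> to \<open>S\<close> is \<open>C\<^sup>1\<close> iff \<open>g \<circ> p\<close> is, and
  convergence for the weak topology is uniform convergence of \<open>g \<circ> p\<close> and of its derivative
  on compact sets.\<close>

definition C1_diffeo :: "('a::real_normed_vector \<Rightarrow> 'b::real_normed_vector) \<Rightarrow> ('b \<Rightarrow> 'b) \<Rightarrow> bool" where
  "C1_diffeo p g \<longleftrightarrow>
     bij_betw g (range p) (range p) \<and>
     C1_map (g \<circ> p) \<and> C1_map (inv_into (range p) g \<circ> p)"

definition weak_C1_continuous_path ::
    "('a::real_normed_vector \<Rightarrow> 'b::real_normed_vector) \<Rightarrow> (real \<Rightarrow> 'b \<Rightarrow> 'b) \<Rightarrow> bool" where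
  "weak_C1_continuous_path p g \<longleftrightarrow>
     (\<forall>t\<^sub>0\<in>{0..1}. \<forall>K. compact K \<longrightarrow>
        uniform_limit K (\<lambda>t. g t \<circ> p) (g t\<^sub>0 \<circ> p) (at t\<^sub>0 within {0..1}) \<and>
        uniform_limit K (\<lambda>t. total_deriv (g t \<circ> p)) (total_deriv (g t\<^sub>0 \<circ> p))
          (at t\<^sub>0 within {0..1}))"

text \<open>Only the restriction of \<open>g\<close> to times in \<open>{0..1}\<close> matters here; the extension to all
  nonnegative times is \<open>extended_isotopy\<close> below.\<close>

definition isotopy_from_id ::
    "('a::real_normed_vector \<Rightarrow> 'b::real_normed_vector) \<Rightarrow> (real \<Rightarrow> 'b \<Rightarrow> 'b) \<Rightarrow> ('b \<Rightarrow> 'b) \<Rightarrow> bool" where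
  "isotopy_from_id p g h \<longleftrightarrow>
     (\<forall>t\<in>{0..1}. C1_diffeo p (g t)) \<and>
     weak_C1_continuous_path p g \<and>
     (\<forall>a\<in>range p. g 0 a = a) \<and> (\<forall>a\<in>range p. g 1 a = h a)"

definition extended_isotopy :: "(real \<Rightarrow> 'b \<Rightarrow> 'b) \<Rightarrow> real \<Rightarrow> 'b \<Rightarrow> 'b" where
  "extended_isotopy g t = g (frac t) \<circ> (g 1 ^^ nat \<lfloor>t\<rfloor>)"

definition is_lift ::
    "(real \<times> real \<Rightarrow> real \<times> real) \<Rightarrow> (complex \<times> real \<Rightarrow> complex \<times> real) \<Rightarrow> bool" where
  "is_lift F f \<longleftrightarrow>
     continuous_on UNIV F \<and> (\<forall>z. annulus_cover (F z) = f (annulus_cover z))"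

definition positive_twist_map :: "(complex \<times> real \<Rightarrow> complex \<times> real) \<Rightarrow> bool" where
  "positive_twist_map f \<longleftrightarrow>
     C1_diffeo annulus_cover f \<and>
     (\<exists>g. isotopy_from_id annulus_cover g f) \<and>
     (\<forall>F. is_lift F f \<longrightarrow>
        (\<forall>x. strict_mono (\<lambda>y. fst (F (x, y))) \<and>
             C1_diffeo (id :: real \<Rightarrow> real) (\<lambda>y. fst (F (x, y)))))"

definition vec_complex :: "real \<times> real \<Rightarrow> complex" where
  "vec_complex v = Complex (fst v) (snd v)"

text \<open>The counterclockwise oriented angle from \<open>u\<close> to \<open>w\<close> (both nonzero), as a point of the unit
  circle: the class of \<open>\<alpha>\<close> such that the rotation by \<open>\<alpha>\<close> sends the direction of \<open>u\<close> to that of \<open>w\<close>.\<close>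

definition oriented_angle :: "real \<times> real \<Rightarrow> real \<times> real \<Rightarrow> complex" where
  "oriented_angle u w = sgn (vec_complex w) / sgn (vec_complex u)"

definition is_angle_lift ::
    "real \<times> real \<Rightarrow> (real \<Rightarrow> real \<times> real \<Rightarrow> real \<times> real) \<Rightarrow> real \<times> real \<Rightarrow> real \<times> real
       \<Rightarrow> (real \<Rightarrow> real) \<Rightarrow> bool" where
  "is_angle_lift X Ft z\<^sub>1 z\<^sub>2 u \<longleftrightarrow>
     continuous_on {0..} u \<and>
     (\<forall>t\<ge>0. cis (u t) =
        oriented_angle X (extended_isotopy Ft t z\<^sub>2 - extended_isotopy Ft t z\<^sub>1))"

text \<open>Two continuous lifts differ by a constant, so the choice of the lift is immaterial. The value
  at \<open>n = 0\<close> is a dummy.\<close>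

definition linking_n ::
    "real \<times> real \<Rightarrow> (real \<Rightarrow> real \<times> real \<Rightarrow> real \<times> real) \<Rightarrow> real \<times> real \<Rightarrow> real \<times> real
       \<Rightarrow> nat \<Rightarrow> real" where
  "linking_n X Ft z\<^sub>1 z\<^sub>2 n =
     (let u = (SOME u. is_angle_lift X Ft z\<^sub>1 z\<^sub>2 u) in (u (real n) - u 0) / real n)"

definition linking ::
    "real \<times> real \<Rightarrow> (real \<Rightarrow> real \<times> real \<Rightarrow> real \<times> real) \<Rightarrow> real \<times> real \<Rightarrow> real \<times> real \<Rightarrow> real" where
  "linking X Ft z\<^sub>1 z\<^sub>2 = lim (linking_n X Ft z\<^sub>1 z\<^sub>2)"

end

theory Submission
  imports Defs
begin

text \<open>Measure angles from the horizontal direction. A point \<open>z\<close> of the closed right half-plane of \<open>p\<close>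
  starts at an angle in \<open>[-\<pi>/2, \<pi>/2]\<close> as seen from \<open>p\<close>. The twist condition makes the image of the
  vertical line through \<open>p\<close> a graph, so the image of the half-plane never lies straight above the
  image of \<open>p\<close>; since the translate \<open>p + (2\<pi>, 0)\<close> keeps the angle \<open>0\<close> during the whole isotopy, the
  final angle of \<open>z\<close> lies in \<open>(-3\<pi>/2, \<pi>/2)\<close>. By symmetry of the pair, an angle in
  \<open>[k\<pi> - \<pi>/2, k\<pi> + \<pi>/2]\<close> is sent into \<open>(k\<pi> - 3\<pi>/2, k\<pi> + \<pi>/2)\<close>, so along the iteration the angle
  never crosses \<open>k\<pi> + \<pi>/2\<close> upwards and loses at most one half-turn of this partition per step.\<close>

section \<open>Continuous angle functions\<close>

lemma connected_avoids_less:
  fixes f :: "'a::topological_space \<Rightarrow> real"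
  assumes "connected S" "continuous_on S f" "a \<in> S" "f a < c"
    and "\<And>x. x \<in> S \<Longrightarrow> f x \<noteq> c" "x \<in> S"
  shows "f x < c"
proof (rule ccontr)
  assume "\<not> f x < c"
  moreover have "connected (f ` S)"
    using assms connected_continuous_image by blast
  ultimately have "c \<in> f ` S"
    using connectedD_interval[of "f ` S" "f a" "f x" c] assms by auto
  then show False
    using assms by auto
qed

lemma connected_avoids_greater:
  fixes f :: "'a::topological_space \<Rightarrow> real"
  assumes "connected S" "continuous_on S f" "a \<in> S" "c < f a"
    and "\<And>x. x \<in> S \<Longrightarrow> f x \<noteq> c" "x \<in> S"
  shows "c < f x"
  using connected_avoids_less[of S "\<lambda>x. - f x" a "- c" x] assms
  by (auto intro: continuous_on_minus)

text \<open>Half-integers are never attained, so connectedness traps all values within 1/2 of the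
  value at \<open>a\<close>, where only one integer lies.\<close>

lemma continuous_Ints_constant:
  fixes f :: "'a::topological_space \<Rightarrow> real"
  assumes "connected S" "continuous_on S f" "\<And>x. x \<in> S \<Longrightarrow> f x \<in> \<int>" "a \<in> S" "x \<in> S"
  shows "f x = f a"
proof -
  have half: "f y \<noteq> of_int k + 1/2" if "y \<in> S" for y k
  proof
    assume "f y = of_int k + 1/2"
    moreover obtain m where "f y = of_int m"
      using assms(3)[OF \<open>y \<in> S\<close>] by (auto elim: Ints_cases)
    ultimately have "real_of_int (2 * m) = real_of_int (2 * k + 1)"
      by simp
    then have "2 * m = 2 * k + 1"
      by (simp only: of_int_eq_iff)
    then show False by presburger
  qed
  obtain m n where mn: "f a = of_int m" "f x = of_int n"
    using assms(3)[of a] assms(3)[of x] assms(4,5) by (auto elim!: Ints_cases)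
  have "f x < of_int m + 1/2"
    by (rule connected_avoids_less[of S f a]) (use assms half mn in auto)
  moreover have "of_int (m - 1) + 1/2 < f x"
    by (rule connected_avoids_greater[of S f a]) (use assms half[of _ "m - 1"] mn in auto)
  ultimately have "n < m + 1" "m - 1 < n"
    unfolding mn by linarith+
  then show ?thesis
    unfolding mn by simp
qed

lemma cis_eq_imp_Ints:
  assumes "cis a = cis b"
  shows "(a - b) / (2 * pi) \<in> \<int>"
proof -
  have "sin a = sin b \<and> cos a = cos b"
    using assms by (auto simp: complex_eq_iff)
  then obtain n :: int where "a = b + 2 * pi * of_int n"
    using sin_cos_eq_iff by metis
  then have "(a - b) / (2 * pi) = of_int n" by simp
  then show ?thesis by simp
qed

text \<open>Divided by \<open>2 * pi\<close>, the difference is continuous and integer-valued. It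
  serves both in time and in space.\<close>

lemma angle_functions_differ_by_constant:
  fixes u v :: "'a::topological_space \<Rightarrow> real"
  assumes "connected S" "continuous_on S u" "continuous_on S v"
    and "\<And>x. x \<in> S \<Longrightarrow> cis (u x) = cis (v x)" "a \<in> S" "x \<in> S"
  shows "u x - v x = u a - v a"
proof -
  have "(u x - v x) / (2 * pi) = (u a - v a) / (2 * pi)"
    using assms
    by (intro continuous_Ints_constant[where f = "\<lambda>x. (u x - v x) / (2 * pi)"])
      (auto intro!: continuous_intros cis_eq_imp_Ints)
  then show ?thesis by simp
qed

text \<open>The angle is the imaginary part of a continuous logarithm.\<close>

lemma continuous_angle_on_contractible:
  fixes f :: "'a::real_normed_vector \<Rightarrow> complex"
  assumes "continuous_on S f" "contractible S" "\<And>x. x \<in> S \<Longrightarrow> f x \<noteq> 0"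
  obtains a where "continuous_on S a" "\<And>x. x \<in> S \<Longrightarrow> cis (a x) = sgn (f x)"
proof -
  obtain g where g: "continuous_on S g" "\<And>x. x \<in> S \<Longrightarrow> f x = exp (g x)"
    using continuous_logarithm_on_contractible[OF assms] by blast
  show thesis
  proof
    show "continuous_on S (\<lambda>x. Im (g x))"
      using g by (auto intro: continuous_intros)
    show "cis (Im (g x)) = sgn (f x)" if "x \<in> S" for x
      using g(2)[OF that] by (simp add: exp_eq_polar sgn_mult sgn_of_real)
  qed
qed

lemma Re_sgn_pos_iff: "0 < Re (sgn z) \<longleftrightarrow> 0 < Re z"
  by (cases "z = 0") (auto simp: Re_sgn zero_less_divide_iff)

text \<open>Here \<open>k\<close> is \<open>x / pi\<close> rounded to a nearest integer. These
  half-open intervals partition the line, and the iteration follows which of them contains the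
  angle.\<close>

lemma half_turn_bracket:
  fixes x :: real
  obtains k :: int where "of_int k * pi - pi/2 \<le> x" "x < of_int k * pi + pi/2"
proof
  have "of_int \<lfloor>x / pi + 1/2\<rfloor> - 1/2 \<le> x / pi" "x / pi < of_int \<lfloor>x / pi + 1/2\<rfloor> + 1/2"
    by linarith+
  then have "(of_int \<lfloor>x / pi + 1/2\<rfloor> - 1/2) * pi \<le> x" "x < (of_int \<lfloor>x / pi + 1/2\<rfloor> + 1/2) * pi"
    by (simp_all only: pos_le_divide_eq[OF pi_gt_zero] pos_divide_less_eq[OF pi_gt_zero])
  then show "of_int \<lfloor>x / pi + 1/2\<rfloor> * pi - pi/2 \<le> x" "x < of_int \<lfloor>x / pi + 1/2\<rfloor> * pi + pi/2"
    by (simp_all add: algebra_simps)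
qed

lemma vec_complex_simps [simp]:
  "Re (vec_complex v) = fst v" "Im (vec_complex v) = snd v"
  "vec_complex 0 = 0" "vec_complex (- v) = - vec_complex v"
  "vec_complex v = 0 \<longleftrightarrow> v = 0"
  by (auto simp: vec_complex_def complex_eq_iff prod_eq_iff)

lemma continuous_on_vec_complex [continuous_intros]:
  "continuous_on S f \<Longrightarrow> continuous_on S (\<lambda>x. vec_complex (f x))"
  unfolding vec_complex_def Complex_eq by (intro continuous_intros)


section \<open>Isotopies from the identity to a twist map of the plane\<close>

text \<open>Interface between annulus and plane: the theorem takes \<open>2 * pi\<close> for
  \<open>c\<close>, and \<open>twist_inverse\<close> makes the time-one image of each vertical line
  a graph over the first coordinate.\<close>

locale planar_twist_isotopy =
  fixes Ft :: "real \<Rightarrow> real \<times> real \<Rightarrow> real \<times> real" and c :: real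
  assumes cont: "continuous_on ({0..1} \<times> UNIV) (\<lambda>(t, z). Ft t z)"
    and inj: "t \<in> {0..1} \<Longrightarrow> Ft t z = Ft t z' \<Longrightarrow> z = z'"
    and start: "Ft 0 z = z"
    and c_pos: "c > 0"
    and period: "t \<in> {0..1} \<Longrightarrow> Ft t (z + (c, 0)) = Ft t z + (c, 0)"
    and twist_mono: "y < y' \<Longrightarrow> fst (Ft 1 (x, y)) < fst (Ft 1 (x, y'))"
    and twist_inverse: "\<exists>g. continuous_on UNIV g \<and> (\<forall>\<xi>. fst (Ft 1 (x, g \<xi>)) = \<xi>)"
begin

lemma continuous_on_Ft [continuous_intros]:
  assumes "continuous_on A f" "continuous_on A h" "\<And>x. x \<in> A \<Longrightarrow> f x \<in> {0..1}"
  shows "continuous_on A (\<lambda>x. Ft (f x) (h x))"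
proof -
  have "continuous_on A (\<lambda>x. case (f x, h x) of (t, z) \<Rightarrow> Ft t z)"
    by (rule continuous_on_compose2[OF cont])
      (use assms in \<open>auto intro: continuous_on_Pair\<close>)
  then show ?thesis by simp
qed

section \<open>Angles of a pair of points over one unit of time\<close>

definition pair_angle :: "real \<times> real \<Rightarrow> real \<times> real \<Rightarrow> (real \<Rightarrow> real) \<Rightarrow> bool" where
  "pair_angle p z u \<longleftrightarrow>
     continuous_on {0..1} u \<and> (\<forall>t\<in>{0..1}. cis (u t) = sgn (vec_complex (Ft t z - Ft t p)))"

lemma pair_angle_neq: "pair_angle p z u \<Longrightarrow> z \<noteq> p"
  by (auto simp: pair_angle_def dest: bspec[of _ _ 0])

text \<open>Swapping the points reverses the vector, which is a rotation by any odd multiple of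
  \<open>pi\<close>. The shift \<open>a\<close> is left free because both \<open>pi\<close> and
  \<open>- (of_int k * pi)\<close> occur later.\<close>

lemma pair_angle_swap:
  assumes "pair_angle p z u" "cis a = -1"
  shows "pair_angle z p (\<lambda>t. u t + a)"
proof -
  have "cis (u t + a) = sgn (vec_complex (Ft t p - Ft t z))" if "t \<in> {0..1}" for t
  proof -
    have "cis (u t + a) = - cis (u t)"
      using assms by (simp flip: cis_mult)
    also have "\<dots> = - sgn (vec_complex (Ft t z - Ft t p))"
      using assms that by (simp add: pair_angle_def)
    also have "\<dots> = sgn (vec_complex (- (Ft t z - Ft t p)))"
      by (simp only: vec_complex_simps sgn_minus)
    finally show ?thesis by simp
  qed
  with assms show ?thesis
    by (auto simp: pair_angle_def intro: continuous_intros)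
qed

lemma pair_angle_shift:
  assumes "pair_angle p z u" "cis a = 1"
  shows "pair_angle p z (\<lambda>t. u t + a)"
  using assms by (auto simp: pair_angle_def simp flip: cis_mult intro: continuous_intros)

lemma pair_angle_unique:
  assumes "pair_angle p z u" "pair_angle p z v" "t \<in> {0..1}"
  shows "u t - v t = u 0 - v 0"
  by (rule angle_functions_differ_by_constant[of "{0..1}"])
    (use assms in \<open>auto simp: pair_angle_def\<close>)

section \<open>The angle seen from a point over its closed right half-plane\<close>

definition right_half_plane :: "real \<times> real \<Rightarrow> (real \<times> real) set" where
  "right_half_plane p = {z. fst p \<le> fst z} - {p}"

text \<open>The centre lies in the open half-plane, so a segment from it meets the boundary line at
  most at its far end, which is not \<open>p\<close>. Starlikeness gives the contractibility needed
  for a global choice of angle.\<close>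

lemma starlike_right_half_plane: "starlike (right_half_plane p)"
  unfolding starlike_def
proof (intro bexI ballI subsetI)
  show "p + (c, 0) \<in> right_half_plane p"
    using c_pos by (auto simp: right_half_plane_def prod_eq_iff)
  fix z x
  assume z: "z \<in> right_half_plane p" and "x \<in> closed_segment (p + (c, 0)) z"
  then obtain s where s: "0 \<le> s" "s \<le> 1" "x = (1 - s) *\<^sub>R (p + (c, 0)) + s *\<^sub>R z"
    by (auto simp: closed_segment_def)
  have fst_x: "fst x - fst p = (1 - s) * c + s * (fst z - fst p)"
    by (simp add: s algebra_simps)
  have "x = z" if "s = 1"
    using s that by simp
  moreover have "fst x - fst p > 0" if "s \<noteq> 1"
    unfolding fst_x using s that z c_pos
    by (intro add_pos_nonneg mult_pos_pos mult_nonneg_nonneg) (auto simp: right_half_plane_def)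
  ultimately show "x \<in> right_half_plane p"
    using z by (cases "s = 1") (auto simp: right_half_plane_def)
qed

lemma connected_right_half_plane: "connected (right_half_plane p)"
  using starlike_right_half_plane by (rule starlike_imp_connected)

text \<open>The normalisation at the translate \<open>p + (c, 0)\<close>, whose angle never moves, pins down the
  branch of the angle on the whole half-plane.\<close>

lemma right_half_plane_angle:
  obtains A :: "real \<Rightarrow> real \<times> real \<Rightarrow> real"
  where "\<And>z. z \<in> right_half_plane p \<Longrightarrow> pair_angle p z (\<lambda>t. A t z)"
    and "\<And>z. z \<in> right_half_plane p \<Longrightarrow> A 0 z = Arg (vec_complex (z - p))"
    and "continuous_on (right_half_plane p) (A 1)"
    and "A 1 (p + (c, 0)) = 0"
proof -
  let ?S = "right_half_plane p" and ?q = "p + (c, 0)"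
  let ?H = "\<lambda>x. vec_complex (Ft (fst x) (snd x) - Ft (fst x) p)"
  have q: "?q \<in> ?S"
    using c_pos by (auto simp: right_half_plane_def prod_eq_iff)
  have "continuous_on ({0..1} \<times> ?S) ?H"
    by (intro continuous_intros) auto
  moreover have "contractible ({0..1::real} \<times> ?S)"
    by (intro contractible_Times starlike_imp_contractible starlike_right_half_plane
        convex_imp_contractible) auto
  moreover have "?H x \<noteq> 0" if "x \<in> {0..1} \<times> ?S" for x
    using that inj[of "fst x" "snd x" p] by (auto simp: right_half_plane_def)
  ultimately obtain a where a: "continuous_on ({0..1} \<times> ?S) a"
      "\<And>x. x \<in> {0..1} \<times> ?S \<Longrightarrow> cis (a x) = sgn (?H x)"
    by (rule continuous_angle_on_contractible) (assumption, rule that)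
  \<comment> \<open>By \<open>q_const\<close> below, \<open>a (0, ?q)\<close> is a multiple of
    \<open>2 * pi\<close>; subtracting it keeps an angle function and makes the angle at
    \<open>?q\<close> start at 0.\<close>
  define A where "A t z = a (t, z) - a (0, ?q)" for t z
  have a_cont: "continuous_on B (\<lambda>x. a (f x, h x))"
    if "continuous_on B f" "continuous_on B h" "\<And>x. x \<in> B \<Longrightarrow> f x \<in> {0..1}" "\<And>x. x \<in> B \<Longrightarrow> h x \<in> ?S"
    for B :: "'c::topological_space set" and f h
    by (rule continuous_on_compose2[OF a(1)]) (use that in \<open>auto intro: continuous_on_Pair\<close>)
  have q_const: "cis (a (t, ?q)) = 1" if "t \<in> {0..1}" for t
  proof -
    have "vec_complex (c, 0) = of_real c"
      by (simp add: complex_eq_iff)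
    then show ?thesis
      using a(2)[of "(t, ?q)"] that q c_pos period by (simp add: sgn_of_real)
  qed
  have A_pair: "pair_angle p z (\<lambda>t. A t z)" if "z \<in> ?S" for z
  proof -
    have "cis (A t z) = cis (a (t, z))" for t
      using q_const[of 0] by (simp add: A_def flip: cis_divide)
    then show ?thesis
      using that a(2) unfolding pair_angle_def
      by (auto simp: A_def intro!: continuous_intros a_cont)
  qed
  show thesis
  proof (rule that[of A])
    show "pair_angle p z (\<lambda>t. A t z)" if "z \<in> ?S" for z
      using A_pair that .
    show "A 0 z = Arg (vec_complex (z - p))" if "z \<in> ?S" for z
    proof -
      \<comment> \<open>Directions in the half-plane miss the cut of \<open>Arg\<close>, so
        \<open>Arg\<close> is a continuous angle there.\<close>
      have "vec_complex (z - p) \<notin> \<real>\<^sub>\<le>\<^sub>0" if "z \<in> ?S" for z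
        using that by (auto simp: right_half_plane_def complex_nonpos_Reals_iff prod_eq_iff)
      then have "continuous_on ?S (\<lambda>z. Arg (vec_complex (z - p)))"
        by (intro continuous_intros) auto
      moreover have "continuous_on ?S (A 0)"
        unfolding A_def by (intro continuous_intros a_cont) auto
      moreover have "cis (A 0 z) = cis (Arg (vec_complex (z - p)))" if "z \<in> ?S" for z
        using A_pair[OF that] that
        by (subst cis_Arg) (auto simp: pair_angle_def start right_half_plane_def)
      ultimately have "A 0 z - Arg (vec_complex (z - p)) = A 0 ?q - Arg (vec_complex (?q - p))"
        using that q connected_right_half_plane
        by (intro angle_functions_differ_by_constant[of ?S])
      moreover have "vec_complex (?q - p) = of_real c"
        by (simp add: complex_eq_iff)
      ultimately show ?thesis
        using c_pos by (simp add: A_def)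
    qed
    show "continuous_on ?S (A 1)"
      unfolding A_def by (intro continuous_intros a_cont) auto
    have "a (1, ?q) - 0 = a (0, ?q) - 0"
      by (rule angle_functions_differ_by_constant[of "{0..1}" "\<lambda>t. a (t, ?q)" "\<lambda>_. 0"])
        (use q q_const in \<open>auto intro!: continuous_intros a_cont\<close>)
    then show "A 1 ?q = 0"
      by (simp add: A_def)
  qed
qed

text \<open>By the twist condition the image of the vertical line through \<open>p\<close> is the graph of a
  continuous function, and the image of the open half-plane lies on one side of it.\<close>

lemma image_right_half_plane_one_side:
  "(\<forall>z\<in>right_half_plane p. fst (Ft 1 z) = fst (Ft 1 p) \<longrightarrow> snd (Ft 1 z) < snd (Ft 1 p)) \<or>
   (\<forall>z\<in>right_half_plane p. fst (Ft 1 z) = fst (Ft 1 p) \<longrightarrow> snd (Ft 1 p) < snd (Ft 1 z))"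
proof -
  obtain g where g: "continuous_on UNIV g" "\<And>\<xi>. fst (Ft 1 (fst p, g \<xi>)) = \<xi>"
    using twist_inverse by blast
  define U where "U = {z :: real \<times> real. fst p < fst z}"
  \<comment> \<open>Signed height of \<open>Ft 1 z\<close> above the image of the vertical line
    through \<open>p\<close>.\<close>
  define h where "h z = snd (Ft 1 z) - snd (Ft 1 (fst p, g (fst (Ft 1 z))))" for z
  have inj1: "y = y'" if "fst (Ft 1 (x, y)) = fst (Ft 1 (x, y'))" for x y y'
    using twist_mono[of y y' x] twist_mono[of y' y x] that by (cases y y' rule: linorder_cases) auto
  have U: "z \<in> U" and hz: "h z = snd (Ft 1 z) - snd (Ft 1 p)"
    if z: "z \<in> right_half_plane p" "fst (Ft 1 z) = fst (Ft 1 p)" for z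
  proof -
    \<comment> \<open>On the boundary line the twist condition makes the first coordinate of the
      image injective, so the point would be \<open>p\<close> itself.\<close>
    have "fst z \<noteq> fst p"
    proof
      assume eq: "fst z = fst p"
      then have "snd z = snd p"
        using inj1[of "fst p" "snd z" "snd p"] z by (metis prod.collapse)
      with eq z show False
        by (auto simp: right_half_plane_def prod_eq_iff)
    qed
    then show "z \<in> U"
      using z by (auto simp: right_half_plane_def U_def)
    have "g (fst (Ft 1 z)) = snd p"
      using g(2)[of "fst (Ft 1 z)"] z by (simp add: inj1[of "fst p"])
    then show "h z = snd (Ft 1 z) - snd (Ft 1 p)"
      by (simp add: h_def)
  qed
  have "convex U"
    using convex_halfspace_gt[of "fst p" "(1, 0) :: real \<times> real"]
    by (simp add: U_def inner_prod_def)
  then have conn: "connected U"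
    by (rule convex_connected)
  have h_cont: "continuous_on U h"
    unfolding h_def
    by (intro continuous_intros continuous_on_compose2[OF g(1)]) auto
  have h_nz: "h z \<noteq> 0" if "z \<in> U" for z
  proof
    \<comment> \<open>Zero height would give \<open>z\<close> the same image as a point of the
      vertical line, against injectivity.\<close>
    assume "h z = 0"
    then have "Ft 1 z = Ft 1 (fst p, g (fst (Ft 1 z)))"
      using g(2) by (auto simp: h_def prod_eq_iff)
    then have "z = (fst p, g (fst (Ft 1 z)))"
      by (rule inj[rotated]) simp
    then have "fst z = fst p"
      by (metis fst_conv)
    with that show False
      by (simp add: U_def)
  qed
  have q: "p + (c, 0) \<in> U"
    using c_pos by (simp add: U_def)
  show ?thesis
  proof (cases "h (p + (c, 0)) < 0")
    case True
    have "h z < 0" if "z \<in> U" for z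
      by (rule connected_avoids_less[OF conn h_cont q]) (use True h_nz that in auto)
    then show ?thesis
      using U hz by fastforce
  next
    case False
    then have pos: "0 < h (p + (c, 0))"
      using h_nz[OF q] by simp
    have "0 < h z" if "z \<in> U" for z
      by (rule connected_avoids_greater[OF conn h_cont q]) (use pos h_nz that in auto)
    then show ?thesis
      using U hz by fastforce
  qed
qed

text \<open>The final angle is continuous on the half-plane and 0 at the translate. By
  \<open>image_right_half_plane_one_side\<close> it avoids all angles pointing straight up, or all
  pointing straight down, so it stays between the two such angles nearest to 0.\<close>

lemma right_half_plane_final_angle:
  "(\<forall>z u. pair_angle p z u \<longrightarrow> u 0 \<in> {-pi/2..pi/2} \<longrightarrow> u 1 \<in> {-3*pi/2<..<pi/2}) \<or>
   (\<forall>z u. pair_angle p z u \<longrightarrow> u 0 \<in> {-pi/2..pi/2} \<longrightarrow> u 1 \<in> {-pi/2<..<3*pi/2})"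
proof -
  obtain A where A: "\<And>z. z \<in> right_half_plane p \<Longrightarrow> pair_angle p z (\<lambda>t. A t z)"
      "\<And>z. z \<in> right_half_plane p \<Longrightarrow> A 0 z = Arg (vec_complex (z - p))"
      "continuous_on (right_half_plane p) (A 1)" "A 1 (p + (c, 0)) = 0"
    using right_half_plane_angle by metis
  have q: "p + (c, 0) \<in> right_half_plane p"
    using c_pos by (auto simp: right_half_plane_def prod_eq_iff)
  \<comment> \<open>The initial bound puts \<open>z\<close> in the half-plane and makes
    \<open>u 0\<close> the principal argument, so \<open>u\<close> is the normalised branch.\<close>
  have reduce: "z \<in> right_half_plane p \<and> u 1 = A 1 z"
    if u: "pair_angle p z u" and u0: "u 0 \<in> {-pi/2..pi/2}" for z u
  proof -
    have cis0: "cis (u 0) = sgn (vec_complex (z - p))"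
      using u by (simp add: pair_angle_def start)
    have "0 \<le> cos (u 0)"
      using u0 by (intro cos_ge_zero) auto
    then have "0 \<le> Re (sgn (vec_complex (z - p)))"
      using cis0 by (metis cis.sel(1))
    then have "0 \<le> fst (z - p)"
      using pair_angle_neq[OF u] by (simp add: Re_sgn zero_le_divide_iff)
    then have z: "z \<in> right_half_plane p"
      using pair_angle_neq[OF u] by (simp add: right_half_plane_def)
    have "Arg (vec_complex (z - p)) = u 0"
      using cis0 u0 pi_gt_zero by (intro cis_Arg_unique) (simp_all only: atLeastAtMost_iff, linarith+)
    then have "u 0 = A 0 z"
      using A(2) z by simp
    then show ?thesis
      using pair_angle_unique[OF u A(1)[OF z], of 1] z by simp
  qed
  \<comment> \<open>A vanishing cosine means that the final vector is vertical; the sine then tells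
    up from down.\<close>
  have final: "fst (Ft 1 z) = fst (Ft 1 p) \<and> sin (A 1 z) = sgn (snd (Ft 1 z) - snd (Ft 1 p))"
    if z: "z \<in> right_half_plane p" and "cos (A 1 z) = 0" for z
  proof -
    have w: "cis (A 1 z) = sgn (vec_complex (Ft 1 z - Ft 1 p))" and "Ft 1 z \<noteq> Ft 1 p"
      using A(1)[OF z] inj[of 1 z p] pair_angle_neq by (auto simp: pair_angle_def)
    then have re: "fst (Ft 1 z) = fst (Ft 1 p)"
      using that by (auto simp: complex_eq_iff Re_sgn)
    then have "vec_complex (Ft 1 z - Ft 1 p) = \<i> * of_real (snd (Ft 1 z) - snd (Ft 1 p))"
      by (simp add: complex_eq_iff)
    then have "cis (A 1 z) = \<i> * of_real (sgn (snd (Ft 1 z) - snd (Ft 1 p)))"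
      using w by (simp only: sgn_mult sgn_of_real) (simp add: sgn_eq)
    then show ?thesis
      using re by (simp add: complex_eq_iff)
  qed
  \<comment> \<open>The angles \<open>pi/2\<close> and \<open>-3*pi/2\<close> point up,
    \<open>-pi/2\<close> and \<open>3*pi/2\<close> point down.\<close>
  have cs: "sin (pi/2) = 1" "cos (pi/2) = 0" "sin (-pi/2) = -1" "cos (-pi/2) = 0"
    "sin (3*pi/2) = -1" "cos (3*pi/2) = 0" "sin (-3*pi/2) = 1" "cos (-3*pi/2) = 0"
    using sin_3over2_pi cos_3over2_pi by (simp_all add: mult.commute)
  have range: "A 1 z \<in> {l<..<r}"
    if "z \<in> right_half_plane p" "l < 0" "0 < r" "\<And>z. z \<in> right_half_plane p \<Longrightarrow> A 1 z \<noteq> l \<and> A 1 z \<noteq> r"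
    for z l r
  proof -
    have "A 1 z < r"
      using connected_right_half_plane A(3) q
      by (rule connected_avoids_less) (use A(4) that in auto)
    moreover have "l < A 1 z"
      using connected_right_half_plane A(3) q
      by (rule connected_avoids_greater) (use A(4) that in auto)
    ultimately show ?thesis by simp
  qed
  from image_right_half_plane_one_side[of p] show ?thesis
  proof
    assume *: "\<forall>z\<in>right_half_plane p. fst (Ft 1 z) = fst (Ft 1 p) \<longrightarrow> snd (Ft 1 z) < snd (Ft 1 p)"
    have "A 1 z \<noteq> -3*pi/2 \<and> A 1 z \<noteq> pi/2" if z: "z \<in> right_half_plane p" for z
    proof -
      have "\<not> (cos (A 1 z) = 0 \<and> sin (A 1 z) = 1)"
        using * final[OF z] z by auto
      then show ?thesis
        using cs by metis
    qed
    then have "A 1 z \<in> {-3*pi/2<..<pi/2}" if "z \<in> right_half_plane p" for z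
      using that by (intro range) simp_all
    then show ?thesis
      using reduce by metis
  next
    assume *: "\<forall>z\<in>right_half_plane p. fst (Ft 1 z) = fst (Ft 1 p) \<longrightarrow> snd (Ft 1 p) < snd (Ft 1 z)"
    have "A 1 z \<noteq> -pi/2 \<and> A 1 z \<noteq> 3*pi/2" if z: "z \<in> right_half_plane p" for z
    proof -
      have "\<not> (cos (A 1 z) = 0 \<and> sin (A 1 z) = -1)"
        using * final[OF z] z by auto
      then show ?thesis
        using cs by metis
    qed
    then have "A 1 z \<in> {-pi/2<..<3*pi/2}" if "z \<in> right_half_plane p" for z
      using that by (intro range) simp_all
    then show ?thesis
      using reduce by metis
  qed
qed

text \<open>The second alternative of the previous lemma is impossible: for a pair of points on a
  vertical line it would give different angle variations to the two orderings of the pair.\<close>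

lemma final_angle_right:
  assumes "pair_angle p z u" "u 0 \<in> {-pi/2..pi/2}"
  shows "u 1 \<in> {-3*pi/2<..<pi/2}"
proof (rule ccontr)
  assume "u 1 \<notin> {-3*pi/2<..<pi/2}"
  \<comment> \<open>A single failure excludes the first alternative at \<open>p\<close>, so the
    second holds for every pair based at \<open>p\<close>.\<close>
  then have alt: "u 1 \<in> {-pi/2<..<3*pi/2}" if "pair_angle p z u" "u 0 \<in> {-pi/2..pi/2}" for z u
    using right_half_plane_final_angle[of p] assms that by blast
  define w where "w = p - (0, 1)"
  have w_eq: "w = (fst p, snd p - 1)"
    by (simp add: w_def prod_eq_iff)
  have up: "vec_complex (p - w) = \<i>" and down: "vec_complex (w - p) = - \<i>"
    by (simp_all add: w_def complex_eq_iff)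
  have w: "w \<in> right_half_plane p" and p: "p \<in> right_half_plane w"
    by (auto simp: w_def right_half_plane_def prod_eq_iff)
  obtain v where v: "pair_angle p w v" "v 0 = -pi/2"
    using right_half_plane_angle[of p] w down by (metis Arg_minus_ii minus_divide_left)
  obtain v' where v': "pair_angle w p v'" "v' 0 = pi/2"
    using right_half_plane_angle[of w] p up by (metis Arg_ii)
  \<comment> \<open>Both \<open>v + pi\<close> and \<open>v'\<close> are angles of the vector from
    \<open>w\<close> to \<open>p\<close>, and both start at \<open>pi/2\<close>.\<close>
  have "v 1 + pi - v' 1 = v 0 + pi - v' 0"
    using pair_angle_unique[OF pair_angle_swap[OF v(1), of pi] v'(1), of 1] by simp
  then have eq: "v' 1 = v 1 + pi"
    using v v' by simp
  \<comment> \<open>The upper point of the vertical pair ends to the right of the lower one.\<close>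
  have "fst (Ft 1 w) < fst (Ft 1 p)"
    using twist_mono[of "snd p - 1" "snd p" "fst p"] by (simp add: w_eq)
  then have "0 < Re (sgn (vec_complex (Ft 1 p - Ft 1 w)))"
    by (simp only: Re_sgn_pos_iff) simp
  also have "\<dots> = cos (v' 1)"
    using v' by (metis cis.sel(1) atLeastAtMost_iff order_refl pair_angle_def zero_le_one)
  finally have pos: "0 < cos (v' 1)" .
  have v1: "v 1 \<in> {-pi/2<..<3*pi/2}"
    using alt v by simp
  have neg: "cos (v 1) < 0"
    using pos eq by simp
  \<comment> \<open>Negative cosine forces \<open>v 1\<close> beyond \<open>pi/2\<close>, hence
    \<open>v' 1\<close> beyond \<open>3*pi/2\<close>, which both alternatives at \<open>w\<close>
    forbid.\<close>
  have "v 1 > pi/2"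
    using cos_ge_zero[of "v 1"] neg v1 by fastforce
  moreover have "v' 0 \<in> {-pi/2..pi/2}"
    using v'(2) pi_gt_zero by (simp only: atLeastAtMost_iff) linarith
  then have "v' 1 \<in> {-3*pi/2<..<pi/2} \<or> v' 1 \<in> {-pi/2<..<3*pi/2}"
    using right_half_plane_final_angle[of w] v'(1) by blast
  then have "v' 1 < 3*pi/2"
    using pi_gt_zero by auto
  ultimately show False
    using eq by simp
qed

text \<open>Subtracting \<open>k * pi\<close> reduces to \<open>final_angle_right\<close>. For odd
  \<open>k\<close> this shift exchanges the two points, so the base point becomes
  \<open>z\<close>.\<close>

lemma final_angle:
  fixes k :: int
  assumes "pair_angle p z u" "u 0 \<in> {of_int k * pi - pi/2..of_int k * pi + pi/2}"
  shows "u 1 \<in> {of_int k * pi - 3*pi/2<..<of_int k * pi + pi/2}"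
proof -
  have "u 1 + - (of_int k * pi) \<in> {-3*pi/2<..<pi/2}"
  proof (cases "even k")
    case True
    then have "cis (- (of_int k * pi)) = 1"
      by (simp add: complex_eq_iff mult.commute[of _ pi])
    then show ?thesis
      using final_angle_right[OF pair_angle_shift[OF assms(1)]] assms(2) by fastforce
  next
    case False
    then have "cis (- (of_int k * pi)) = -1"
      by (simp add: complex_eq_iff mult.commute[of _ pi])
    then show ?thesis
      using final_angle_right[OF pair_angle_swap[OF assms(1)]] assms(2) by fastforce
  qed
  then show ?thesis by auto
qed

section \<open>Iteration along the extended isotopy and the linking number\<close>

lemma extended_isotopy_step:
  assumes "s \<in> {0..1}"
  shows "extended_isotopy Ft (real n + s) z = Ft s ((Ft 1 ^^ n) z)"
proof (cases "s = 1")
  \<comment> \<open>At \<open>s = 1\<close> the floor has already jumped to \<open>n + 1\<close> and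
    the fractional part is 0; the values agree since \<open>Ft 0\<close> is the identity.\<close>
  case True
  have "nat \<lfloor>real (Suc n)\<rfloor> = Suc n" "frac (real (Suc n)) = 0"
    by (simp_all only: floor_of_nat nat_int frac_def of_int_of_nat_eq diff_self)
  then have "extended_isotopy Ft (real (Suc n)) z = (Ft 1 ^^ Suc n) z"
    by (simp only: extended_isotopy_def start o_apply)
  then show ?thesis
    using True by (simp add: add.commute)
next
  case False
  then have "\<lfloor>real n + s\<rfloor> = int n"
    using assms by (simp add: floor_eq_iff)
  then show ?thesis
    by (simp add: extended_isotopy_def frac_def)
qed

lemma extended_isotopy_inj:
  assumes "0 \<le> t" "extended_isotopy Ft t z = extended_isotopy Ft t z'"
  shows "z = z'"
proof -
  have iter: "z = z'" if "(Ft 1 ^^ n) z = (Ft 1 ^^ n) z'" for n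
    using that by (induction n) (auto dest: inj[of 1, rotated])
  have "frac t \<in> {0..1}"
    using frac_lt_1[of t] by auto
  then have "(Ft 1 ^^ nat \<lfloor>t\<rfloor>) z = (Ft 1 ^^ nat \<lfloor>t\<rfloor>) z'"
    by (rule inj) (use assms in \<open>simp add: extended_isotopy_def\<close>)
  then show ?thesis
    by (rule iter)
qed

text \<open>Closed unit pieces, each a path of \<open>Ft\<close> starting at an iterate, are glued;
  continuity at \<open>t\<close> is then tested on a longer initial interval.\<close>

lemma continuous_on_extended_isotopy: "continuous_on {0..} (\<lambda>t. extended_isotopy Ft t z)"
proof -
  have piece: "continuous_on {real n..real n + 1} (\<lambda>t. extended_isotopy Ft t z)" for n
  proof -
    have "continuous_on {real n..real n + 1} (\<lambda>t. Ft (t - real n) ((Ft 1 ^^ n) z))"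
      by (intro continuous_intros) auto
    moreover have "Ft (t - real n) ((Ft 1 ^^ n) z) = extended_isotopy Ft t z"
      if "t \<in> {real n..real n + 1}" for t
      using extended_isotopy_step[of "t - real n" n z] that by simp
    ultimately show ?thesis
      by (rule continuous_on_eq)
  qed
  have initial: "continuous_on {0..real n} (\<lambda>t. extended_isotopy Ft t z)" for n
  proof (induction n)
    case (Suc n)
    have "{0..real (Suc n)} = {0..real n} \<union> {real n..real n + 1}"
      by auto
    with Suc piece show ?case
      by (metis closed_atLeastAtMost continuous_on_closed_Un)
  qed simp
  show ?thesis
    unfolding continuous_on_eq_continuous_within
  proof
    fix t :: real assume t: "t \<in> {0..}"
    obtain n where n: "t < real n"
      using reals_Archimedean2 by blast
    then have "continuous (at t within {0..real n}) (\<lambda>t. extended_isotopy Ft t z)"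
      using initial[of n] t by (simp add: continuous_on_eq_continuous_within)
    moreover have "at t within {0..} = at t within {0..real n}"
      by (rule at_within_nhd[where S = "{..<real n}"]) (use n in auto)
    ultimately show "continuous (at t within {0..}) (\<lambda>t. extended_isotopy Ft t z)"
      by simp
  qed
qed

text \<open>By \<open>final_angle\<close>, an angle in the half-turn interval numbered
  \<open>j\<close> moves into the one numbered \<open>j\<close> or \<open>j - 1\<close>. After
  \<open>n\<close> steps the number therefore lies between \<open>k - n\<close> and
  \<open>k\<close>.\<close>

lemma angle_bounds:
  fixes k :: int
  assumes u_cont: "continuous_on {0..} u"
    and u: "\<And>t. 0 \<le> t \<Longrightarrow>
      cis (u t) = sgn (vec_complex (extended_isotopy Ft t z\<^sub>2 - extended_isotopy Ft t z\<^sub>1))"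
    and k: "of_int k * pi - pi/2 \<le> u 0" "u 0 < of_int k * pi + pi/2"
  shows "of_int (k - int n) * pi - pi/2 \<le> u (real n) \<and> u (real n) < of_int k * pi + pi/2"
proof (induction n)
  case 0
  then show ?case using k by simp
next
  case (Suc n)
  have "continuous_on {0..1} (\<lambda>s. u (real n + s))"
    by (rule continuous_on_compose2[OF u_cont]) (auto intro!: continuous_intros)
  then have "pair_angle ((Ft 1 ^^ n) z\<^sub>1) ((Ft 1 ^^ n) z\<^sub>2) (\<lambda>s. u (real n + s))"
    unfolding pair_angle_def using u by (auto simp: extended_isotopy_step)
  moreover obtain j where j: "of_int j * pi - pi/2 \<le> u (real n)" "u (real n) < of_int j * pi + pi/2"
    using half_turn_bracket by blast
  ultimately have next_u: "u (real (Suc n)) \<in> {of_int j * pi - 3*pi/2<..<of_int j * pi + pi/2}"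
    using final_angle[of _ _ "\<lambda>s. u (real n + s)" j] by (simp add: add.commute)
  \<comment> \<open>The strict real inequality between multiples of \<open>pi\<close> becomes the
    integer bound \<open>j < k + 1\<close>.\<close>
  have "of_int j * pi < of_int (k + 1) * pi"
    using j Suc by (simp add: algebra_simps)
  then have "j \<le> k"
    by (simp only: mult_less_cancel_right_pos[OF pi_gt_zero] of_int_less_iff)
  then have "of_int j * pi \<le> of_int k * pi"
    by simp
  moreover have "of_int (k - int n) * pi < of_int (j + 1) * pi"
    using j Suc by (simp add: algebra_simps)
  then have "k - int n \<le> j"
    by (simp only: mult_less_cancel_right_pos[OF pi_gt_zero] of_int_less_iff)
  then have "of_int (k - int (Suc n)) * pi \<le> of_int (j - 1) * pi"
    by simp
  ultimately have "of_int (k - int (Suc n)) * pi - pi/2 \<le> of_int j * pi - 3*pi/2"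
    "of_int j * pi + pi/2 \<le> of_int k * pi + pi/2"
    by (simp_all add: algebra_simps)
  then show ?case
    using next_u by (simp only: greaterThanLessThan_iff) linarith
qed

lemma is_angle_lift_exists:
  assumes "X \<noteq> 0" "z\<^sub>1 \<noteq> z\<^sub>2"
  shows "\<exists>u. is_angle_lift X Ft z\<^sub>1 z\<^sub>2 u"
proof -
  let ?H = "\<lambda>t. vec_complex (extended_isotopy Ft t z\<^sub>2 - extended_isotopy Ft t z\<^sub>1)"
  have "continuous_on {0..} ?H"
    by (intro continuous_intros continuous_on_extended_isotopy)
  moreover have "contractible {0::real..}"
    by (simp add: convex_imp_contractible)
  moreover have "?H t \<noteq> 0" if "t \<in> {0..}" for t
    using extended_isotopy_inj[of t z\<^sub>2 z\<^sub>1] assms that by auto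
  ultimately obtain a where a: "continuous_on {0..} a" "\<And>t. t \<in> {0..} \<Longrightarrow> cis (a t) = sgn (?H t)"
    by (rule continuous_angle_on_contractible) (assumption, rule that)
  \<comment> \<open>The angle \<open>a\<close> is measured from the horizontal; subtracting the
    argument of \<open>X\<close> makes it relative to \<open>X\<close>.\<close>
  have "is_angle_lift X Ft z\<^sub>1 z\<^sub>2 (\<lambda>t. a t - Arg (vec_complex X))"
    using a assms unfolding is_angle_lift_def
    by (auto simp: oriented_angle_def cis_Arg simp flip: cis_divide intro!: continuous_intros)
  then show ?thesis by blast
qed

lemma linking_n_bounds:
  assumes "X \<noteq> 0" "z\<^sub>1 \<noteq> z\<^sub>2" "0 < n"
  shows "- pi - pi / real n \<le> linking_n X Ft z\<^sub>1 z\<^sub>2 n" "linking_n X Ft z\<^sub>1 z\<^sub>2 n \<le> pi / real n"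
proof -
  define u where "u = (SOME u. is_angle_lift X Ft z\<^sub>1 z\<^sub>2 u)"
  have lift: "is_angle_lift X Ft z\<^sub>1 z\<^sub>2 u"
    unfolding u_def using is_angle_lift_exists[OF assms(1,2)] by (rule someI_ex)
  have linking_eq: "linking_n X Ft z\<^sub>1 z\<^sub>2 n = (u (real n) - u 0) / real n"
    by (simp add: linking_n_def u_def Let_def)
  \<comment> \<open>Back to angles from the horizontal; the constant cancels in differences.\<close>
  define v where "v t = u t + Arg (vec_complex X)" for t
  have v_cont: "continuous_on {0..} v"
    using lift by (auto simp: v_def is_angle_lift_def intro!: continuous_intros)
  have v: "cis (v t) = sgn (vec_complex (extended_isotopy Ft t z\<^sub>2 - extended_isotopy Ft t z\<^sub>1))"
    if "0 \<le> t" for t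
    using lift that assms(1)
    by (auto simp: v_def is_angle_lift_def oriented_angle_def cis_Arg sgn_zero_iff simp flip: cis_mult)
  obtain k where "of_int k * pi - pi/2 \<le> v 0" "v 0 < of_int k * pi + pi/2"
    using half_turn_bracket by blast
  \<comment> \<open>The unknown position of \<open>v 0\<close> in its interval of length
    \<open>pi\<close> costs an error of at most \<open>pi\<close>, which vanishes after division by
    \<open>n\<close>.\<close>
  then have "- real n * pi - pi \<le> v (real n) - v 0" "v (real n) - v 0 \<le> pi"
    using angle_bounds[OF v_cont v, of k n] by (simp_all add: algebra_simps)
  then have "- real n * pi - pi \<le> u (real n) - u 0" "u (real n) - u 0 \<le> pi"
    by (simp_all add: v_def)
  then show "- pi - pi / real n \<le> linking_n X Ft z\<^sub>1 z\<^sub>2 n" "linking_n X Ft z\<^sub>1 z\<^sub>2 n \<le> pi / real n"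
    using assms(3)
      divide_right_mono[of "- real n * pi - pi" "u (real n) - u 0" "real n"]
      divide_right_mono[of "u (real n) - u 0" pi "real n"]
    by (simp_all add: linking_eq diff_divide_distrib)
qed

lemma linking_in_interval:
  assumes "X \<noteq> 0" "z\<^sub>1 \<noteq> z\<^sub>2" "convergent (linking_n X Ft z\<^sub>1 z\<^sub>2)"
  shows "linking X Ft z\<^sub>1 z\<^sub>2 \<in> {- pi..0}"
proof -
  have lim: "linking_n X Ft z\<^sub>1 z\<^sub>2 \<longlonglongrightarrow> linking X Ft z\<^sub>1 z\<^sub>2"
    using assms(3) by (simp add: linking_def convergent_LIMSEQ_iff)
  have inv: "(\<lambda>n. pi / real n) \<longlonglongrightarrow> 0"
    by (rule lim_const_over_n)
  have low: "(\<lambda>n. - pi - pi / real n) \<longlonglongrightarrow> - pi"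
    using tendsto_diff[OF tendsto_const inv, of "- pi"] by simp
  show ?thesis
    \<comment> \<open>The bounds are available from index 1 on.\<close>
    using LIMSEQ_le[OF low lim] LIMSEQ_le[OF lim inv] linking_n_bounds[OF assms(1,2)]
    by (metis atLeastAtMost_iff less_le_trans zero_less_one)
qed

end


section \<open>Lifts of isotopies of the annulus\<close>

text \<open>Uniformity on the compact unit ball around the base point controls the change of time;
  continuity of one map controls the change of point.\<close>

lemma continuous_on_Times_compact_uniform_limit:
  fixes g :: "'a::metric_space \<Rightarrow> 'b::heine_borel \<Rightarrow> 'c::metric_space"
  assumes cont: "\<And>t. t \<in> T \<Longrightarrow> continuous_on UNIV (g t)"
    and unif: "\<And>t K. t \<in> T \<Longrightarrow> compact K \<Longrightarrow> uniform_limit K g (g t) (at t within T)"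
  shows "continuous_on (T \<times> UNIV) (\<lambda>(t, z). g t z)"
  unfolding continuous_on_iff
proof (intro ballI allI impI)
  fix x :: "'a \<times> 'b" and e :: real
  assume "x \<in> T \<times> UNIV" "0 < e"
  obtain t\<^sub>0 z\<^sub>0 where x: "x = (t\<^sub>0, z\<^sub>0)" by (cases x)
  have t\<^sub>0: "t\<^sub>0 \<in> T"
    using \<open>x \<in> T \<times> UNIV\<close> x by simp
  have "\<forall>\<^sub>F t in at t\<^sub>0 within T. \<forall>z\<in>cball z\<^sub>0 1. dist (g t z) (g t\<^sub>0 z) < e/2"
    using \<open>0 < e\<close> by (intro uniform_limitD unif t\<^sub>0) auto
  then obtain d\<^sub>1 where d\<^sub>1: "0 < d\<^sub>1"
    "\<And>t z. t \<in> T \<Longrightarrow> t \<noteq> t\<^sub>0 \<Longrightarrow> dist t t\<^sub>0 < d\<^sub>1 \<Longrightarrow> z \<in> cball z\<^sub>0 1 \<Longrightarrow> dist (g t z) (g t\<^sub>0 z) < e/2"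
    unfolding eventually_at by blast
  obtain d\<^sub>2 where d\<^sub>2: "0 < d\<^sub>2" "\<And>z. dist z z\<^sub>0 < d\<^sub>2 \<Longrightarrow> dist (g t\<^sub>0 z) (g t\<^sub>0 z\<^sub>0) < e/2"
    using cont[OF t\<^sub>0] \<open>0 < e\<close> unfolding continuous_on_iff by (metis UNIV_I half_gt_zero)
  show "\<exists>d>0. \<forall>x'\<in>T \<times> UNIV. dist x' x < d \<longrightarrow>
      dist (case x' of (t, z) \<Rightarrow> g t z) (case x of (t, z) \<Rightarrow> g t z) < e"
  proof (intro exI conjI ballI impI)
    show "0 < min 1 (min d\<^sub>1 d\<^sub>2)"
      using d\<^sub>1 d\<^sub>2 by simp
    fix x' assume x': "x' \<in> T \<times> UNIV" "dist x' x < min 1 (min d\<^sub>1 d\<^sub>2)"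
    obtain t z where tz: "x' = (t, z)" by (cases x')
    have "dist t t\<^sub>0 \<le> dist x' x" "dist z z\<^sub>0 \<le> dist x' x"
      using dist_fst_le[of x' x] dist_snd_le[of x' x] by (simp_all add: x tz)
    then have near: "dist t t\<^sub>0 < d\<^sub>1" "dist z z\<^sub>0 < d\<^sub>2" "z \<in> cball z\<^sub>0 1"
      using x' by (auto simp: dist_commute)
    have "dist (g t z) (g t\<^sub>0 z) < e/2"
      \<comment> \<open>The filter excludes the base time, where the distance is 0.\<close>
      using d\<^sub>1(2)[of t z] near x' tz \<open>0 < e\<close> by (cases "t = t\<^sub>0") auto
    moreover have "dist (g t\<^sub>0 z) (g t\<^sub>0 z\<^sub>0) < e/2"
      using d\<^sub>2 near by blast
    ultimately show "dist (case x' of (t, z) \<Rightarrow> g t z) (case x of (t, z) \<Rightarrow> g t z) < e"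
      using dist_triangle_half_l[of "g t z" "g t\<^sub>0 z" e "g t\<^sub>0 z\<^sub>0"]
      by (simp add: x tz dist_triangle_lt[of _ "g t\<^sub>0 z"] dist_commute)
  qed
qed

lemma C1_map_continuous: "C1_map f \<Longrightarrow> continuous_on UNIV f"
  by (simp add: C1_map_def continuous_at_imp_continuous_on differentiable_imp_continuous_within)

lemma isotopy_from_id_jointly_continuous:
  assumes "isotopy_from_id id Ft (F :: real \<times> real \<Rightarrow> real \<times> real)"
  shows "continuous_on ({0..1} \<times> UNIV) (\<lambda>(t, z). Ft t z)"
proof (rule continuous_on_Times_compact_uniform_limit)
  show "continuous_on UNIV (Ft t)" if "t \<in> {0..1}" for t
    using assms that C1_map_continuous by (fastforce simp: isotopy_from_id_def C1_diffeo_def)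
  show "uniform_limit K Ft (Ft t) (at t within {0..1})" if "t \<in> {0..1}" "compact K" for t K
    using assms that by (auto simp: isotopy_from_id_def weak_C1_continuous_path_def)
qed

text \<open>The two first coordinates agree modulo \<open>2 * pi\<close> at every time, so their
  difference keeps its initial value \<open>2 * pi\<close>.\<close>

lemma lifted_isotopy_commutes_with_translation:
  assumes iso: "isotopy_from_id id Ft F"
    and lift: "\<forall>t\<in>{0..1}. is_lift (Ft t) (ft t)"
    and t: "t \<in> {0..1}"
  shows "Ft t (z + (2 * pi, 0)) = Ft t z + (2 * pi, 0)"
proof -
  let ?z' = "z + (2 * pi, 0)"
  have "annulus_cover ?z' = annulus_cover z"
    by (simp add: annulus_cover_def flip: cis_mult)
  then have cover: "annulus_cover (Ft s ?z') = annulus_cover (Ft s z)" if "s \<in> {0..1}" for s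
    using lift that by (metis is_lift_def)
  have cont: "continuous_on {0..1} (\<lambda>s. fst (Ft s y))" for y
    using continuous_on_compose2[OF isotopy_from_id_jointly_continuous[OF iso], of "{0..1}" "\<lambda>s. (s, y)"]
    by (simp add: image_subset_iff continuous_on_fst continuous_on_Pair)
  have start: "Ft 0 y = y" for y
    using iso by (cases y) (simp add: isotopy_from_id_def)
  have "fst (Ft t ?z') - fst (Ft t z) = fst (Ft 0 ?z') - fst (Ft 0 z)"
    by (rule angle_functions_differ_by_constant[of "{0..1}"])
      (use cont cover t in \<open>auto simp: annulus_cover_def\<close>)
  then show ?thesis
    using cover[OF t] by (simp add: start prod_eq_iff annulus_cover_def)
qed

lemma C1_diffeo_line_inverse:
  assumes "C1_diffeo (id :: real \<Rightarrow> real) \<phi>"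
  shows "\<exists>g. continuous_on UNIV g \<and> (\<forall>\<xi>. \<phi> (g \<xi>) = \<xi>)"
proof (intro exI conjI allI)
  show "continuous_on UNIV (inv \<phi>)"
    using assms C1_map_continuous by (fastforce simp: C1_diffeo_def)
  show "\<phi> (inv \<phi> \<xi>) = \<xi>" for \<xi>
    using assms by (simp add: C1_diffeo_def bij_betw_def surj_f_inv_f)
qed

theorem corollary1p2:
  fixes f :: "complex \<times> real \<Rightarrow> complex \<times> real"
    and ft :: "real \<Rightarrow> complex \<times> real \<Rightarrow> complex \<times> real"
    and F :: "real \<times> real \<Rightarrow> real \<times> real"
    and Ft :: "real \<Rightarrow> real \<times> real \<Rightarrow> real \<times> real"
    and X z\<^sub>1 z\<^sub>2 :: "real \<times> real"
  assumes "positive_twist_map f"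
    and "is_lift F f"
    and "isotopy_from_id annulus_cover ft f"
    and "isotopy_from_id id Ft F"
    and "\<forall>t\<in>{0..1}. is_lift (Ft t) (ft t)"
    and "X \<noteq> 0"
    and "z\<^sub>1 \<noteq> z\<^sub>2"
    and "convergent (linking_n X Ft z\<^sub>1 z\<^sub>2)"
  shows "linking X Ft z\<^sub>1 z\<^sub>2 \<in> {- pi..0}"
proof -
  have F: "Ft 1 = F" "Ft 0 z = z" for z
    using assms(4) unfolding isotopy_from_id_def by (cases z, auto)+
  have twist: "strict_mono (\<lambda>y. fst (F (x, y)))" "C1_diffeo id (\<lambda>y. fst (F (x, y)))" for x
    using assms(1,2) by (auto simp: positive_twist_map_def)
  interpret planar_twist_isotopy Ft "2 * pi"
  proof
    show "z = z'" if "t \<in> {0..1}" "Ft t z = Ft t z'" for t z z'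
      using assms(4) that by (auto simp: isotopy_from_id_def C1_diffeo_def bij_betw_def dest: injD)
  qed (use twist F assms in \<open>auto simp: strict_mono_def
      intro: isotopy_from_id_jointly_continuous C1_diffeo_line_inverse
        lifted_isotopy_commutes_with_translation\<close>)
  show ?thesis
    using assms by (intro linking_in_interval)
qed

end
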